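(* Let $\mathsf V$ be a subvariety of the variety $\mathsf{ROL}$ of residuated ortholattices such that there is a term $t(x,y)$ in the language $\{\wedge,\vee,\neg,0,1\}$ with $\mathsf V\models t(x,y)\approx x\backslash y$. Then every member of $\mathsf V$ is an orthomodular lattice (i.e., $\mathsf V$ is a variety of orthomodular lattices).
   Context: A bounded involutive lattice is a bounded lattice $(A,\wedge,\vee,0,1)$ with an order-reversing involution $\neg$. The Sasaki product is $x\cdot y:=x\wedge(\neg x\vee y)$. A residuated ortholattice is an algebra $(A,\wedge,\vee,\neg,\backslash,0,1)$ whose $\{\wedge,\vee,\neg,0,1\}$-reduct is a bounded involutive lattice and such that $x\cdot y\le z\iff y\le x\backslash z$ for all $x,y,z$; these form a variety $\mathsf{ROL}$. An ortholattice is a bounded involutive lattice satisfying $x\wedge\neg x\approx 0$; an orthomodular lattice is an ortholattice satisfying $x\le y\implies y\approx x\vee(y\wedge\neg x)$. *)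

theory Defs
  imports "HOL-Algebra.Congruence"
begin

text \<open>Algebras are records with an explicit carrier. The residual is added by record
  extension, so that predicates on the record \<open>bil\<close> apply directly to the
  \<open>{meet, join, neg, zero, one}\<close>-reduct of an algebra with a residual.\<close>

record 'a bil = "'a partial_object" +
  meet :: "'a \<Rightarrow> 'a \<Rightarrow> 'a" (infixl \<open>\<sqinter>\<index>\<close> 70)
  join :: "'a \<Rightarrow> 'a \<Rightarrow> 'a" (infixl \<open>\<squnion>\<index>\<close> 65)
  neg :: "'a \<Rightarrow> 'a" (\<open>\<sim>\<index> _\<close> [81] 80)
  bzero :: 'a (\<open>\<zero>\<index>\<close>)
  bone :: 'a (\<open>\<one>\<index>\<close>)

record 'a rol = "'a bil" +
  resid :: "'a \<Rightarrow> 'a \<Rightarrow> 'a" (infixr \<open>\<rightharpoondown>\<index>\<close> 60)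

locale bil_algebra =
  fixes A :: "('a, 'm) bil_scheme" (structure)
  assumes meet_closed: "x \<in> carrier A \<Longrightarrow> y \<in> carrier A \<Longrightarrow> x \<sqinter> y \<in> carrier A"
    and join_closed: "x \<in> carrier A \<Longrightarrow> y \<in> carrier A \<Longrightarrow> x \<squnion> y \<in> carrier A"
    and neg_closed: "x \<in> carrier A \<Longrightarrow> \<sim> x \<in> carrier A"
    and zero_closed: "\<zero> \<in> carrier A"
    and one_closed: "\<one> \<in> carrier A"

locale rol_algebra = bil_algebra A for A :: "('a, 'm) rol_scheme" (structure) +
  assumes resid_closed: "x \<in> carrier A \<Longrightarrow> y \<in> carrier A \<Longrightarrow> x \<rightharpoondown> y \<in> carrier A"

definition ble :: "('a, 'm) bil_scheme \<Rightarrow> 'a \<Rightarrow> 'a \<Rightarrow> bool" (infix \<open>\<preceq>\<index>\<close> 50)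
  where "x \<preceq>\<^bsub>A\<^esub> y \<longleftrightarrow> x \<sqinter>\<^bsub>A\<^esub> y = x"

locale bounded_involutive_lattice = bil_algebra +
  assumes meet_comm: "x \<in> carrier A \<Longrightarrow> y \<in> carrier A \<Longrightarrow> x \<sqinter> y = y \<sqinter> x"
    and join_comm: "x \<in> carrier A \<Longrightarrow> y \<in> carrier A \<Longrightarrow> x \<squnion> y = y \<squnion> x"
    and meet_assoc: "x \<in> carrier A \<Longrightarrow> y \<in> carrier A \<Longrightarrow> z \<in> carrier A
      \<Longrightarrow> (x \<sqinter> y) \<sqinter> z = x \<sqinter> (y \<sqinter> z)"
    and join_assoc: "x \<in> carrier A \<Longrightarrow> y \<in> carrier A \<Longrightarrow> z \<in> carrier A
      \<Longrightarrow> (x \<squnion> y) \<squnion> z = x \<squnion> (y \<squnion> z)"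
    and meet_absorb: "x \<in> carrier A \<Longrightarrow> y \<in> carrier A \<Longrightarrow> x \<sqinter> (x \<squnion> y) = x"
    and join_absorb: "x \<in> carrier A \<Longrightarrow> y \<in> carrier A \<Longrightarrow> x \<squnion> (x \<sqinter> y) = x"
    and zero_least: "x \<in> carrier A \<Longrightarrow> \<zero> \<preceq> x"
    and one_greatest: "x \<in> carrier A \<Longrightarrow> x \<preceq> \<one>"
    and neg_neg: "x \<in> carrier A \<Longrightarrow> \<sim> (\<sim> x) = x"
    and neg_antitone: "x \<in> carrier A \<Longrightarrow> y \<in> carrier A \<Longrightarrow> x \<preceq> y \<Longrightarrow> \<sim> y \<preceq> \<sim> x"

definition sasaki :: "('a, 'm) bil_scheme \<Rightarrow> 'a \<Rightarrow> 'a \<Rightarrow> 'a" (infixl \<open>\<odot>\<index>\<close> 70)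
  where "x \<odot>\<^bsub>A\<^esub> y = x \<sqinter>\<^bsub>A\<^esub> (\<sim>\<^bsub>A\<^esub> x \<squnion>\<^bsub>A\<^esub> y)"

locale residuated_ortholattice = bounded_involutive_lattice A + rol_algebra A
  for A :: "('a, 'm) rol_scheme" (structure) +
  assumes residuation: "x \<in> carrier A \<Longrightarrow> y \<in> carrier A \<Longrightarrow> z \<in> carrier A
      \<Longrightarrow> x \<odot> y \<preceq> z \<longleftrightarrow> y \<preceq> x \<rightharpoondown> z"

locale ortholattice = bounded_involutive_lattice +
  assumes meet_neg: "x \<in> carrier A \<Longrightarrow> x \<sqinter> \<sim> x = \<zero>"

locale orthomodular_lattice = ortholattice +
  assumes orthomodular: "x \<in> carrier A \<Longrightarrow> y \<in> carrier A \<Longrightarrow> x \<preceq> y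
      \<Longrightarrow> y = x \<squnion> (y \<sqinter> \<sim> x)"

datatype (tvars: 'v) rterm =
    Var 'v
  | Meet "'v rterm" "'v rterm"
  | Join "'v rterm" "'v rterm"
  | Neg "'v rterm"
  | Resid "'v rterm" "'v rterm"
  | Zero
  | One

primrec eval :: "('a, 'm) rol_scheme \<Rightarrow> ('v \<Rightarrow> 'a) \<Rightarrow> 'v rterm \<Rightarrow> 'a" where
  "eval A \<sigma> (Var v) = \<sigma> v"
| "eval A \<sigma> (Meet s t) = eval A \<sigma> s \<sqinter>\<^bsub>A\<^esub> eval A \<sigma> t"
| "eval A \<sigma> (Join s t) = eval A \<sigma> s \<squnion>\<^bsub>A\<^esub> eval A \<sigma> t"
| "eval A \<sigma> (Neg s) = \<sim>\<^bsub>A\<^esub> (eval A \<sigma> s)"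
| "eval A \<sigma> (Resid s t) = eval A \<sigma> s \<rightharpoondown>\<^bsub>A\<^esub> eval A \<sigma> t"
| "eval A \<sigma> Zero = \<zero>\<^bsub>A\<^esub>"
| "eval A \<sigma> One = \<one>\<^bsub>A\<^esub>"

primrec resid_free :: "'v rterm \<Rightarrow> bool" where
  "resid_free (Var v) \<longleftrightarrow> True"
| "resid_free (Meet s t) \<longleftrightarrow> resid_free s \<and> resid_free t"
| "resid_free (Join s t) \<longleftrightarrow> resid_free s \<and> resid_free t"
| "resid_free (Neg s) \<longleftrightarrow> resid_free s"
| "resid_free (Resid s t) \<longleftrightarrow> False"
| "resid_free Zero \<longleftrightarrow> True"
| "resid_free One \<longleftrightarrow> True"

definition satisfies :: "('a, 'm) rol_scheme \<Rightarrow> 'v rterm \<Rightarrow> 'v rterm \<Rightarrow> bool"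
  where "satisfies A s t \<longleftrightarrow> (\<forall>\<sigma>. range \<sigma> \<subseteq> carrier A \<longrightarrow> eval A \<sigma> s = eval A \<sigma> t)"

definition models :: "'a rol set \<Rightarrow> 'v rterm \<Rightarrow> 'v rterm \<Rightarrow> bool"
  where "models V s t \<longleftrightarrow> (\<forall>A\<in>V. satisfies A s t)"

text \<open>A variety is an equational class. HOL has no quantification over types, so a class of
  algebras is represented by its members with carrier in an arbitrary type \<open>'a\<close>.\<close>

definition variety :: "'a rol set \<Rightarrow> bool"
  where "variety V \<longleftrightarrow> (\<exists>E :: (nat rterm \<times> nat rterm) set.
    V = {A. rol_algebra A \<and> (\<forall>(s, t)\<in>E. satisfies A s t)})"

definition ROL :: "'a rol set"
  where "ROL = {A. residuated_ortholattice A}"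

definition subvariety :: "'a rol set \<Rightarrow> 'a rol set \<Rightarrow> bool"
  where "subvariety V W \<longleftrightarrow> variety V \<and> V \<subseteq> W"

end

theory Submission
  imports Defs
begin

text \<open>A residual-free term evaluated at \<open>x\<close> and \<open>\<zero>\<close> stays in the subalgebra
  \<open>{\<zero>, x, \<sim> x, \<one>}\<close> of the ortholattice reduct, and among these four elements only \<open>\<sim> x\<close> can be
  \<open>x \<rightharpoondown> \<zero>\<close>. Hence \<open>x \<odot> y = \<zero>\<close> forces \<open>y \<preceq> \<sim> x\<close>. For \<open>z \<preceq> y\<close> this says that
  \<open>y \<sqinter> \<sim> z = y \<odot> \<sim> z = \<zero>\<close> implies \<open>y = z\<close>, which is equivalent to orthomodularity.\<close>

section \<open>Order facts and unit laws in bounded involutive lattices\<close>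

context bounded_involutive_lattice
begin

lemma ble_antisym:
  "x \<in> carrier A \<Longrightarrow> y \<in> carrier A \<Longrightarrow> x \<preceq> y \<Longrightarrow> y \<preceq> x \<Longrightarrow> x = y"
  unfolding ble_def using meet_comm by metis

lemma ble_trans:
  "x \<in> carrier A \<Longrightarrow> y \<in> carrier A \<Longrightarrow> z \<in> carrier A \<Longrightarrow> x \<preceq> y \<Longrightarrow> y \<preceq> z \<Longrightarrow> x \<preceq> z"
  unfolding ble_def using meet_assoc by metis

lemma meet_idem: "x \<in> carrier A \<Longrightarrow> x \<sqinter> x = x"
  using meet_absorb join_absorb meet_closed by metis

lemma join_idem: "x \<in> carrier A \<Longrightarrow> x \<squnion> x = x"
  using meet_absorb join_absorb join_closed by metis

lemma ble_iff_join: "x \<in> carrier A \<Longrightarrow> y \<in> carrier A \<Longrightarrow> x \<preceq> y \<longleftrightarrow> x \<squnion> y = y"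
  unfolding ble_def using meet_absorb join_absorb join_comm meet_comm by metis

lemma meet_lower1: "x \<in> carrier A \<Longrightarrow> y \<in> carrier A \<Longrightarrow> x \<sqinter> y \<preceq> x"
  unfolding ble_def using meet_assoc meet_comm meet_idem meet_closed by metis

lemma meet_lower2: "x \<in> carrier A \<Longrightarrow> y \<in> carrier A \<Longrightarrow> x \<sqinter> y \<preceq> y"
  using meet_lower1 meet_comm by metis

lemma meet_greatest:
  "x \<in> carrier A \<Longrightarrow> y \<in> carrier A \<Longrightarrow> z \<in> carrier A \<Longrightarrow> z \<preceq> x \<Longrightarrow> z \<preceq> y \<Longrightarrow> z \<preceq> x \<sqinter> y"
  unfolding ble_def using meet_assoc by metis

lemma join_upper1: "x \<in> carrier A \<Longrightarrow> y \<in> carrier A \<Longrightarrow> x \<preceq> x \<squnion> y"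
  unfolding ble_def by (rule meet_absorb)

lemma join_upper2: "x \<in> carrier A \<Longrightarrow> y \<in> carrier A \<Longrightarrow> y \<preceq> x \<squnion> y"
  using join_upper1 join_comm by metis

lemma join_least:
  "x \<in> carrier A \<Longrightarrow> y \<in> carrier A \<Longrightarrow> z \<in> carrier A \<Longrightarrow> x \<preceq> z \<Longrightarrow> y \<preceq> z \<Longrightarrow> x \<squnion> y \<preceq> z"
  using ble_iff_join join_assoc join_closed by metis

lemma meet_zero: "x \<in> carrier A \<Longrightarrow> x \<sqinter> \<zero> = \<zero>" "x \<in> carrier A \<Longrightarrow> \<zero> \<sqinter> x = \<zero>"
  using zero_least zero_closed meet_comm unfolding ble_def by metis+

lemma meet_one: "x \<in> carrier A \<Longrightarrow> x \<sqinter> \<one> = x" "x \<in> carrier A \<Longrightarrow> \<one> \<sqinter> x = x"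
  using one_greatest one_closed meet_comm unfolding ble_def by metis+

lemma join_zero: "x \<in> carrier A \<Longrightarrow> x \<squnion> \<zero> = x" "x \<in> carrier A \<Longrightarrow> \<zero> \<squnion> x = x"
  using zero_least zero_closed join_comm ble_iff_join by metis+

lemma join_one: "x \<in> carrier A \<Longrightarrow> x \<squnion> \<one> = \<one>" "x \<in> carrier A \<Longrightarrow> \<one> \<squnion> x = \<one>"
  using one_greatest one_closed join_comm ble_iff_join by metis+

lemma neg_zero: "\<sim> \<zero> = \<one>"
  by (metis ble_antisym neg_antitone neg_closed neg_neg one_closed one_greatest zero_closed zero_least)

lemma neg_one: "\<sim> \<one> = \<zero>"
  using neg_neg neg_zero zero_closed by metis

end

text \<open>De Morgan dual of \<open>meet_neg\<close>: the complement of the join lies below both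
  \<open>\<sim> x\<close> and \<open>\<sim> (\<sim> x)\<close>, which meet in
  \<open>\<zero>\<close>.\<close>

lemma (in ortholattice) join_neg:
  assumes x: "x \<in> carrier A"
  shows "x \<squnion> \<sim> x = \<one>"
proof -
  let ?j = "x \<squnion> \<sim> x"
  have j: "?j \<in> carrier A" using x by (simp add: join_closed neg_closed)
  have "\<sim> ?j \<preceq> \<sim> x" "\<sim> ?j \<preceq> \<sim> (\<sim> x)"
    using x j by (simp_all add: neg_antitone neg_closed join_upper1 join_upper2)
  then have "\<sim> ?j \<preceq> \<sim> x \<sqinter> \<sim> (\<sim> x)"
    using x j by (simp add: meet_greatest neg_closed)
  then have "\<sim> ?j = \<zero>"
    using x j by (simp add: meet_neg neg_closed zero_closed ble_antisym zero_least)
  then show ?thesis using j neg_neg neg_zero by metis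
qed

section \<open>Residuals with respect to zero, and orthomodularity\<close>

context residuated_ortholattice
begin

lemma sasaki_resid_zero:
  assumes x: "x \<in> carrier A"
  shows "x \<odot> (x \<rightharpoondown> \<zero>) = \<zero>"
proof -
  have r: "x \<rightharpoondown> \<zero> \<in> carrier A" using x by (simp add: resid_closed zero_closed)
  have "x \<rightharpoondown> \<zero> \<preceq> x \<rightharpoondown> \<zero>" using r unfolding ble_def by (rule meet_idem)
  then have "x \<odot> (x \<rightharpoondown> \<zero>) \<preceq> \<zero>" using residuation x r zero_closed by metis
  then show ?thesis
    unfolding ble_def using x r
    by (simp add: sasaki_def meet_zero meet_closed join_closed neg_closed)
qed

text \<open>The product \<open>x \<odot> \<zero>\<close> is \<open>x \<sqinter> \<sim> x\<close>,
  and residuation reduces \<open>x \<odot> \<zero> \<preceq> \<zero>\<close> to the trivial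
  \<open>\<zero> \<preceq> x \<rightharpoondown> \<zero>\<close>.\<close>

lemma ortholattice: "ortholattice A"
proof
  fix x assume x: "x \<in> carrier A"
  have "\<zero> \<preceq> x \<rightharpoondown> \<zero>" using x by (simp add: zero_least resid_closed zero_closed)
  then have "x \<odot> \<zero> \<preceq> \<zero>" using residuation x zero_closed by metis
  then show "x \<sqinter> \<sim> x = \<zero>"
    unfolding ble_def using x
    by (simp add: sasaki_def meet_zero meet_closed join_zero neg_closed)
qed

sublocale ortholattice A by (rule ortholattice)

text \<open>Complementation makes the four-element set closed under meet, join and negation;
  induction on the term does the rest, since \<open>resid_free\<close> rules out
  \<open>Resid\<close>.\<close>

lemma eval_resid_free_in_generated:
  assumes x: "x \<in> carrier A"
    and \<sigma>: "\<And>v. \<sigma> v \<in> {\<zero>, x, \<sim> x, \<one>}"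
  shows "resid_free t \<Longrightarrow> eval A \<sigma> t \<in> {\<zero>, x, \<sim> x, \<one>}"
proof -
  let ?S = "{\<zero>, x, \<sim> x, \<one>}"
  have nx: "\<sim> x \<in> carrier A" using x by (rule neg_closed)
  \<comment> \<open>The case checks below use no commutativity, so the swapped forms of
    \<open>meet_neg\<close> and \<open>join_neg\<close> are supplied.\<close>
  have comm: "\<sim> x \<sqinter> x = \<zero>" "\<sim> x \<squnion> x = \<one>"
    using x nx meet_neg join_neg meet_comm join_comm by metis+
  note simps = x nx comm zero_closed one_closed meet_neg join_neg meet_zero meet_one join_zero
    join_one meet_idem join_idem neg_neg neg_zero neg_one
  have meet: "a \<sqinter> b \<in> ?S" if "a \<in> ?S" "b \<in> ?S" for a b
    using that by (auto simp: simps)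
  have join: "a \<squnion> b \<in> ?S" if "a \<in> ?S" "b \<in> ?S" for a b
    using that by (auto simp: simps)
  have neg: "\<sim> a \<in> ?S" if "a \<in> ?S" for a
    using that by (auto simp: simps)
  show "resid_free t \<Longrightarrow> eval A \<sigma> t \<in> ?S"
  proof (induction t)
    case (Var v)
    show ?case using \<sigma>[of v] by simp
  next
    case (Meet s t)
    \<comment> \<open>Without \<open>insert_iff\<close> membership in the set stays a single atom
      that matches the closure fact.\<close>
    then show ?case using meet by (simp del: insert_iff)
  next
    case (Join s t)
    then show ?case using join by (simp del: insert_iff)
  next
    case (Neg s)
    then show ?case using neg by (simp del: insert_iff)
  qed simp_all
qed

text \<open>Residuation gives \<open>\<sim> x \<preceq> x \<rightharpoondown> \<zero>\<close> as
  well as \<open>x \<odot> (x \<rightharpoondown> \<zero>) = \<zero>\<close>; under these bounds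
  each of the other three candidates coincides with \<open>\<sim> x\<close>.\<close>

lemma resid_zero_eq_neg:
  assumes x: "x \<in> carrier A" and mem: "x \<rightharpoondown> \<zero> \<in> {\<zero>, x, \<sim> x, \<one>}"
  shows "x \<rightharpoondown> \<zero> = \<sim> x"
proof -
  let ?r = "x \<rightharpoondown> \<zero>"
  have nx: "\<sim> x \<in> carrier A" using x by (rule neg_closed)
  have "x \<odot> \<sim> x = \<zero>" using x nx by (simp add: sasaki_def join_idem meet_neg)
  then have "x \<odot> \<sim> x \<preceq> \<zero>" by (simp add: zero_least zero_closed)
  then have ge: "\<sim> x \<preceq> ?r" using residuation x nx zero_closed by metis
  have r0: "x \<sqinter> (\<sim> x \<squnion> ?r) = \<zero>" using sasaki_resid_zero[OF x] by (simp add: sasaki_def)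
  consider "?r = \<zero>" | "?r = x \<or> ?r = \<one>" | "?r = \<sim> x" using mem by blast
  then show ?thesis
  proof cases
    case 1
    then show ?thesis using ge nx by (simp add: ble_def meet_zero)
  next
    case 2
    \<comment> \<open>Either value makes this join \<open>\<one>\<close>, so \<open>r0\<close>
      collapses to \<open>x = \<zero>\<close>, and then \<open>ge\<close> forces the residual up to
      \<open>\<one>\<close>, which is \<open>\<sim> x\<close>.\<close>
    then have "\<sim> x \<squnion> ?r = \<one>"
      using join_neg[OF x] join_comm[OF x nx] join_one[OF nx] by auto
    then have "x = \<zero>" using r0 x by (simp add: meet_one)
    then have "\<sim> x = \<one>" by (simp add: neg_zero)
    moreover have "?r \<in> carrier A" using x by (simp add: resid_closed zero_closed)
    ultimately show ?thesis using ge by (simp add: ble_def meet_one)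
  qed
qed

text \<open>With \<open>z = x \<squnion> (y \<sqinter> \<sim> x)\<close>, the inequality
  \<open>z \<preceq> y\<close> holds in any bounded involutive lattice. The converse comes from
  \<open>y \<sqinter> \<sim> z = \<zero>\<close>, which the hypothesis on residuals turns into
  \<open>\<sim> z \<preceq> \<sim> y\<close>.\<close>

lemma orthomodular_if_resid_zero_eq_neg:
  assumes res: "\<And>x. x \<in> carrier A \<Longrightarrow> x \<rightharpoondown> \<zero> = \<sim> x"
  shows "orthomodular_lattice A"
proof
  fix x y assume x: "x \<in> carrier A" and y: "y \<in> carrier A" and le: "x \<preceq> y"
  let ?m = "y \<sqinter> \<sim> x"
  let ?z = "x \<squnion> ?m"
  let ?w = "y \<sqinter> \<sim> ?z"
  have nx: "\<sim> x \<in> carrier A" and ny: "\<sim> y \<in> carrier A" using x y by (simp_all add: neg_closed)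
  have m: "?m \<in> carrier A" using y nx by (rule meet_closed)
  have z: "?z \<in> carrier A" using x m by (rule join_closed)
  have nz: "\<sim> ?z \<in> carrier A" and nm: "\<sim> ?m \<in> carrier A" using z m by (simp_all add: neg_closed)
  have w: "?w \<in> carrier A" using y nz by (rule meet_closed)
  have zy: "?z \<preceq> y" using x y m nx le by (simp add: join_least meet_lower1)
  have wy: "?w \<preceq> y" and wz: "?w \<preceq> \<sim> ?z" using y nz by (simp_all add: meet_lower1 meet_lower2)
  have "\<sim> ?z \<preceq> \<sim> x" "\<sim> ?z \<preceq> \<sim> ?m"
    using neg_antitone[OF x z] neg_antitone[OF m z] x m by (simp_all add: join_upper1 join_upper2)
  then have wx: "?w \<preceq> \<sim> x" and wm: "?w \<preceq> \<sim> ?m"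
    using ble_trans[OF w nz nx wz] ble_trans[OF w nz nm wz] by simp_all
  \<comment> \<open>Being below \<open>y\<close> and \<open>\<sim> x\<close>, \<open>?w\<close> is
    below \<open>?m\<close>; being below \<open>\<sim> ?z\<close>, it is also below
    \<open>\<sim> ?m\<close>.\<close>
  have "?w \<preceq> ?m \<sqinter> \<sim> ?m"
    by (intro meet_greatest wy wx wm) (use y nx m nm w in simp_all)
  then have w0: "?w = \<zero>" using w by (simp add: meet_neg m ble_def meet_zero)
  have "\<sim> y \<preceq> \<sim> ?z" using neg_antitone[OF z y zy] .
  \<comment> \<open>As \<open>\<sim> y \<preceq> \<sim> ?z\<close>, the join in the Sasaki product
    is \<open>\<sim> ?z\<close>, so the product is \<open>?w\<close>.\<close>
  then have "y \<odot> \<sim> ?z = \<zero>" using w0 ny nz by (simp add: sasaki_def ble_iff_join)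
  then have "y \<odot> \<sim> ?z \<preceq> \<zero>" by (simp add: zero_least zero_closed)
  then have "\<sim> ?z \<preceq> \<sim> y" using residuation[OF y nz zero_closed] res[OF y] by simp
  then have "y \<preceq> ?z" using neg_antitone[OF nz ny] y z neg_neg by metis
  then show "y = ?z" using ble_antisym[OF y z] zy by simp
qed

end

theorem theorem2p7:
  fixes V :: "'a rol set"
  assumes "subvariety V ROL"
    and "\<exists>t :: nat rterm. resid_free t \<and> tvars t \<subseteq> {0, 1} \<and>
           models V t (Resid (Var 0) (Var 1))"
  shows "\<forall>A\<in>V. orthomodular_lattice A"
proof
  fix A assume A: "A \<in> V"
  then interpret residuated_ortholattice A
    using assms(1) by (auto simp: subvariety_def ROL_def)
  obtain t :: "nat rterm" where t: "resid_free t"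
    and "models V t (Resid (Var 0) (Var 1))"
    using assms(2) by blast
  then have sat: "satisfies A t (Resid (Var 0) (Var 1))"
    using A by (simp add: models_def)
  have "x \<rightharpoondown>\<^bsub>A\<^esub> \<zero>\<^bsub>A\<^esub> = \<sim>\<^bsub>A\<^esub> x" if x: "x \<in> carrier A" for x
  proof (rule resid_zero_eq_neg[OF x])
    \<comment> \<open>Variable 0 becomes \<open>x\<close> and variable 1 becomes zero, so the
      identity evaluates to the residual of zero by \<open>x\<close>; the default zero keeps all
      values in the carrier and in the four-element set.\<close>
    define \<sigma> where "\<sigma> = (\<lambda>n::nat. if n = 0 then x else \<zero>\<^bsub>A\<^esub>)"
    have "range \<sigma> \<subseteq> carrier A" using x zero_closed by (auto simp: \<sigma>_def)
    then have "eval A \<sigma> t = x \<rightharpoondown>\<^bsub>A\<^esub> \<zero>\<^bsub>A\<^esub>"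
      using sat by (auto simp: satisfies_def \<sigma>_def)
    moreover have "eval A \<sigma> t \<in> {\<zero>\<^bsub>A\<^esub>, x, \<sim>\<^bsub>A\<^esub> x, \<one>\<^bsub>A\<^esub>}"
      by (rule eval_resid_free_in_generated[OF x _ t]) (simp add: \<sigma>_def)
    ultimately show "x \<rightharpoondown>\<^bsub>A\<^esub> \<zero>\<^bsub>A\<^esub> \<in> {\<zero>\<^bsub>A\<^esub>, x, \<sim>\<^bsub>A\<^esub> x, \<one>\<^bsub>A\<^esub>}" by metis
  qed
  then show "orthomodular_lattice A" by (rule orthomodular_if_resid_zero_eq_neg)
qed

end
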